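(* Let $G$ be an index coding problem with side information subsets $A_1,\dots,A_n$ satisfying $$A_j\subseteq\{j-1,j+1\}\quad\text{for all } j\in[1:n],$$ and $$A_j\subsetneq\{j-1,j+1\}\quad\text{for some } j\in[1:n],$$ where indices are taken cyclically modulo $n$. Then the MAIS outer bound is tight for $G$; that is, the capacity region of $G$ equals the set of all nonnegative real tuples $(R_1,\dots,R_n)$ such that $\sum_{j\in S}R_j\le 1$ for every $S\subseteq[1:n]$ for which $G|_S$ is acyclic.
   Context: Index coding problem: let $n\ge 1$ and $[1:n]=\{1,\dots,n\}$. An index coding problem is specified by side information subsets $A_1,\dots,A_n$ with $A_j\subseteq[1:n]\setminus\{j\}$, or equivalently by its side information graph $G=(V,E)$, the directed graph (no self-loops, no parallel edges) with $V=[1:n]$ and an edge $i\to j$ if and only if $i\in A_j$. Index code: for nonnegative integers $t_1,\dots,t_n$ and a positive integer $r$, a $(t_1,\dots,t_n,r)$ index code for $G$ consists of an encoder $\phi:\prod_{i=1}^n\{0,1\}^{t_i}\to\{0,1\}^r$ and decoders $\psi_j:\{0,1\}^r\times\prod_{k\in A_j}\{0,1\}^{t_k}\to\{0,1\}^{t_j}$, $j\in[1:n]$, such that $\psi_j(\phi(x^n),(x_k)_{k\in A_j})=x_j$ for all $j\in[1:n]$ and all $x^n=(x_1,\dots,x_n)\in\prod_{i=1}^n\{0,1\}^{t_i}$. Capacity region: a tuple $(R_1,\dots,R_n)$ of nonnegative reals is achievable for $G$ if there exists a $(t_1,\dots,t_n,r)$ index code for $G$ with $R_j\le t_j/r$ for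 all $j\in[1:n]$. The capacity region of $G$ is the closure of the set of achievable rate tuples. For $S\subseteq V$, $G|_S$ denotes the vertex induced subgraph on $S$; it is acyclic if it contains no directed cycle. Directed cycles have length at least $2$; a pair of opposite edges $i\to j$, $j\to i$ is a directed cycle of length $2$. *)

theory Defs
  imports "HOL-Analysis.Analysis"
begin

definition index_coding_problem :: "nat \<Rightarrow> (nat \<Rightarrow> nat set) \<Rightarrow> bool" where
  "index_coding_problem n A \<longleftrightarrow> n \<ge> 1 \<and> (\<forall>j\<in>{1..n}. A j \<subseteq> {1..n} - {j})"

definition side_info_graph :: "nat \<Rightarrow> (nat \<Rightarrow> nat set) \<Rightarrow> (nat \<times> nat) set" where
  "side_info_graph n A = {(i, j). i \<in> {1..n} \<and> j \<in> {1..n} \<and> i \<in> A j}"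

definition induced_subgraph :: "('v \<times> 'v) set \<Rightarrow> 'v set \<Rightarrow> ('v \<times> 'v) set" where
  "induced_subgraph E S = E \<inter> S \<times> S"

definition bits :: "nat \<Rightarrow> bool list set" where
  "bits m = {w. length w = m}"

definition messages :: "nat set \<Rightarrow> (nat \<Rightarrow> nat) \<Rightarrow> (nat \<Rightarrow> bool list) set" where
  "messages K t = (\<Pi>\<^sub>E k\<in>K. bits (t k))"

definition is_index_code ::
  "nat \<Rightarrow> (nat \<Rightarrow> nat set) \<Rightarrow> (nat \<Rightarrow> nat) \<Rightarrow> nat \<Rightarrow>
   ((nat \<Rightarrow> bool list) \<Rightarrow> bool list) \<Rightarrow>
   (nat \<Rightarrow> bool list \<times> (nat \<Rightarrow> bool list) \<Rightarrow> bool list) \<Rightarrow> bool" where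
  "is_index_code n A t r \<phi> \<psi> \<longleftrightarrow>
     r > 0 \<and>
     \<phi> \<in> messages {1..n} t \<rightarrow> bits r \<and>
     (\<forall>j\<in>{1..n}. \<psi> j \<in> bits r \<times> messages (A j) t \<rightarrow> bits (t j)) \<and>
     (\<forall>j\<in>{1..n}. \<forall>x\<in>messages {1..n} t. \<psi> j (\<phi> x, restrict x (A j)) = x j)"

text \<open>Tuples indexed by \<open>{1..n}\<close> are represented as extensional functions, the carrier of
  the product space \<open>powertop_real {1..n}\<close>, which is Euclidean \<open>n\<close>-space.\<close>

definition achievable_rates :: "nat \<Rightarrow> (nat \<Rightarrow> nat set) \<Rightarrow> (nat \<Rightarrow> real) set" where
  "achievable_rates n A =
     {R \<in> {1..n} \<rightarrow>\<^sub>E {0..}.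
        \<exists>t r \<phi> \<psi>. is_index_code n A t r \<phi> \<psi> \<and> (\<forall>j\<in>{1..n}. R j \<le> real (t j) / real r)}"

definition capacity_region :: "nat \<Rightarrow> (nat \<Rightarrow> nat set) \<Rightarrow> (nat \<Rightarrow> real) set" where
  "capacity_region n A = powertop_real {1..n} closure_of achievable_rates n A"

definition MAIS_region :: "nat \<Rightarrow> (nat \<Rightarrow> nat set) \<Rightarrow> (nat \<Rightarrow> real) set" where
  "MAIS_region n A =
     {R \<in> {1..n} \<rightarrow>\<^sub>E {0..}.
        \<forall>S\<subseteq>{1..n}. acyclic (induced_subgraph (side_info_graph n A) S) \<longrightarrow> (\<Sum>j\<in>S. R j) \<le> 1}"

definition cyc_pred :: "nat \<Rightarrow> nat \<Rightarrow> nat" where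
  "cyc_pred n j = (if j = 1 then n else j - 1)"

definition cyc_succ :: "nat \<Rightarrow> nat \<Rightarrow> nat" where
  "cyc_succ n j = (if j = n then 1 else j + 1)"

end

theory Submission
  imports Defs
begin

text \<open>
  The outer bound holds for every problem: once the messages outside an acyclic set \<open>S\<close> are fixed,
  the codeword determines the messages in \<open>S\<close> one after another along a topological order.

  For the converse, rounding down reduces the claim to integer message lengths \<open>t\<close> with
  \<open>sum t S \<le> r\<close> for all acyclic \<open>S\<close>.  Call a set independent if it contains no pair of opposite
  edges.  Suppose first that every independent set is acyclic.  Some pair of cyclic neighbours is not
  joined in both directions; cutting the cycle there leaves a path, along which one greedily sends
  the not yet transmitted bits of each vertex, each superposed with a bit of the next vertex
  whenever the two know each other.  The length of this code is the weight of an independent set.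
  Otherwise the graph is a directed cycle through all vertices.  Then one sends all messages except
  a shortest one, superposing the shortest one on each of the others: the errors of all vertices
  coincide, and the one known neighbour of a vertex resolves the ambiguity.
\<close>

section \<open>The outer bound\<close>

lemma card_bits: "card (bits m) = 2 ^ m"
  using card_lists_length_eq[of "UNIV :: bool set" m] by (simp add: bits_def)

lemma finite_bits: "finite (bits m)"
  using finite_lists_length_eq[of "UNIV :: bool set" m] by (simp add: bits_def)

lemma length_message: "x \<in> messages K t \<Longrightarrow> k \<in> K \<Longrightarrow> length (x k) = t k"
  by (auto simp: messages_def bits_def)

lemma index_code_acyclic_bound:
  assumes icp: "index_coding_problem n A" and code: "is_index_code n A t r \<phi> \<psi>"
    and S: "S \<subseteq> {1..n}" and ac: "acyclic (induced_subgraph (side_info_graph n A) S)"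
  shows "sum t S \<le> r"
proof -
  let ?G = "induced_subgraph (side_info_graph n A) S"
  have finS: "finite S" using S finite_subset by blast
  \<comment> \<open>Messages outside \<open>S\<close> are frozen to zeros, so a codeword becomes a
    function of the messages in \<open>S\<close> alone.\<close>
  define ext where "ext x = (\<lambda>k\<in>{1..n}. if k \<in> S then x k else replicate (t k) False)"
    for x :: "nat \<Rightarrow> bool list"
  have ext: "ext x \<in> messages {1..n} t" if "x \<in> messages S t" for x
    using that by (auto simp: ext_def messages_def bits_def)
  have "finite ?G"
    using finS by (auto simp: induced_subgraph_def)
  then have wf: "wf ?G" using ac finite_acyclic_wf by blast
  have "inj_on (\<lambda>x. \<phi> (ext x)) (messages S t)"
  proof (rule inj_onI)
    fix x y assume x: "x \<in> messages S t" and y: "y \<in> messages S t" and eq: "\<phi> (ext x) = \<phi> (ext y)"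
    have "k \<in> S \<longrightarrow> x k = y k" for k
    \<comment> \<open>Side information of \<open>j\<close> inside \<open>S\<close> consists of
      predecessors of \<open>j\<close> and is already settled; the rest is frozen by
      \<open>ext\<close>.\<close>
    proof (induction k rule: wf_induct_rule[OF wf])
      case (1 j)
      show ?case
      proof
        assume j: "j \<in> S"
        then have jn: "j \<in> {1..n}" using S by auto
        then have "A j \<subseteq> {1..n}" using icp by (auto simp: index_coding_problem_def)
        then have "restrict (ext x) (A j) = restrict (ext y) (A j)"
          using 1 j jn by (auto simp: ext_def induced_subgraph_def side_info_graph_def intro!: restrict_ext)
        then have "ext x j = ext y j"
          using code ext[OF x] ext[OF y] eq jn unfolding is_index_code_def by metis
        then show "x j = y j" using j jn by (auto simp: ext_def)
      qed
    qed
    then show "x = y" using x y unfolding messages_def by (metis PiE_ext)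
  qed
  moreover have "(\<lambda>x. \<phi> (ext x)) ` messages S t \<subseteq> bits r"
    using code ext by (auto simp: is_index_code_def)
  ultimately have "card (messages S t) \<le> card (bits r)"
    using card_inj_on_le finite_bits by blast
  moreover have "card (messages S t) = 2 ^ sum t S"
    using finS by (simp add: messages_def card_PiE card_bits power_sum)
  ultimately show ?thesis by (simp add: card_bits)
qed

lemma achievable_subset_MAIS:
  assumes icp: "index_coding_problem n A"
  shows "achievable_rates n A \<subseteq> MAIS_region n A"
proof
  fix R assume "R \<in> achievable_rates n A"
  then obtain t r \<phi> \<psi> where R: "R \<in> {1..n} \<rightarrow>\<^sub>E {0..}" and code: "is_index_code n A t r \<phi> \<psi>"
    and le: "\<forall>j\<in>{1..n}. R j \<le> real (t j) / real r"
    by (auto simp: achievable_rates_def)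
  have "sum R S \<le> 1" if S: "S \<subseteq> {1..n}" "acyclic (induced_subgraph (side_info_graph n A) S)" for S
  proof -
    have "sum R S \<le> (\<Sum>j\<in>S. real (t j) / real r)" using le S by (intro sum_mono) auto
    also have "\<dots> = real (sum t S) / real r" by (simp add: sum_divide_distrib)
    also have "\<dots> \<le> 1"
      using index_code_acyclic_bound[OF icp code S] code
      by (simp add: is_index_code_def del: of_nat_sum)
    finally show ?thesis .
  qed
  then show "R \<in> MAIS_region n A" using R by (simp add: MAIS_region_def)
qed

lemma closedin_MAIS_region: "closedin (powertop_real {1..n}) (MAIS_region n A)"
proof -
  let ?X = "powertop_real {1..n}"
  let ?\<S> = "{S. S \<subseteq> {1..n} \<and> acyclic (induced_subgraph (side_info_graph n A) S)}"
  \<comment> \<open>Inserting the whole space makes the family visibly nonempty, as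
    \<open>closedin_Inter\<close> demands.\<close>
  have eq: "MAIS_region n A = \<Inter> (insert (topspace ?X)
      ((\<lambda>S. {R \<in> topspace ?X. sum R S \<in> {..1}}) ` ?\<S> \<union>
       (\<lambda>j. {R \<in> topspace ?X. R j \<in> {0..}}) ` {1..n}))"
    by (auto simp: MAIS_region_def PiE_def Pi_def ball_Un)
  show ?thesis unfolding eq
  proof (rule closedin_Inter, simp, elim insertE UnE imageE; simp only:)
    fix S assume "S \<in> ?\<S>"
    then have "continuous_map ?X euclideanreal (\<lambda>R. \<Sum>j\<in>S. R j)"
      by (intro continuous_map_sum continuous_map_product_projection) (auto intro: finite_subset)
    then show "closedin ?X {R \<in> topspace ?X. sum R S \<in> {..1}}"
      by (rule closedin_continuous_map_preimage) auto
  next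
    fix j assume "j \<in> {1..n}"
    then have "continuous_map ?X euclideanreal (\<lambda>R. R j)"
      by (rule continuous_map_product_projection)
    then show "closedin ?X {R \<in> topspace ?X. R j \<in> {0..}}"
      by (rule closedin_continuous_map_preimage) auto
  qed (rule closedin_topspace)
qed

section \<open>From integer codes to the capacity region\<close>

lemma floor_rate_tendsto:
  fixes x :: real
  assumes "0 \<le> x"
  shows "(\<lambda>m. real (nat \<lfloor>x * real (Suc m)\<rfloor>) / real (Suc m)) \<longlonglongrightarrow> x"
proof (rule tendsto_sandwich)
  have fl: "real (nat \<lfloor>x * real (Suc m)\<rfloor>) = of_int \<lfloor>x * real (Suc m)\<rfloor>" for m
    using assms by simp
  show "\<forall>\<^sub>F m in sequentially.
      x - 1 / real (Suc m) \<le> real (nat \<lfloor>x * real (Suc m)\<rfloor>) / real (Suc m)"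
  proof (intro always_eventually allI)
    fix m
    have "x * real (Suc m) - 1 \<le> of_int \<lfloor>x * real (Suc m)\<rfloor>" by linarith
    then show "x - 1 / real (Suc m) \<le> real (nat \<lfloor>x * real (Suc m)\<rfloor>) / real (Suc m)"
      unfolding fl by (simp add: pos_le_divide_eq left_diff_distrib del: of_nat_Suc)
  qed
  show "\<forall>\<^sub>F m in sequentially. real (nat \<lfloor>x * real (Suc m)\<rfloor>) / real (Suc m) \<le> x"
    unfolding fl by (intro always_eventually allI) (simp add: pos_divide_le_eq del: of_nat_Suc)
  show "(\<lambda>m. x - 1 / real (Suc m)) \<longlonglongrightarrow> x"
    using tendsto_diff[OF tendsto_const LIMSEQ_inverse_real_of_nat, of x]
    by (simp add: divide_inverse)
qed simp

text \<open>A tuple of the region, scaled by \<open>Suc m\<close> and rounded down, meets the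
  integer bounds with \<open>r = Suc m\<close> and so has a code. The rates of these codes converge
  to the tuple, and the capacity region is closed.\<close>

lemma MAIS_tightI:
  assumes icp: "index_coding_problem n A"
    and codes: "\<And>t r. r > 0 \<Longrightarrow>
      (\<And>S. S \<subseteq> {1..n} \<Longrightarrow> acyclic (induced_subgraph (side_info_graph n A) S) \<Longrightarrow> sum t S \<le> r) \<Longrightarrow>
      \<exists>\<phi> \<psi>. is_index_code n A t r \<phi> \<psi>"
  shows "capacity_region n A = MAIS_region n A"
proof
  show "capacity_region n A \<subseteq> MAIS_region n A"
    unfolding capacity_region_def
    by (intro closure_of_minimal achievable_subset_MAIS icp closedin_MAIS_region)
  show "MAIS_region n A \<subseteq> capacity_region n A"
  proof
    fix R assume R: "R \<in> MAIS_region n A"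
    then have Rext: "R \<in> extensional {1..n}" and Rpos: "j \<in> {1..n} \<Longrightarrow> 0 \<le> R j" for j
      by (auto simp: MAIS_region_def PiE_def)
    define t where "t m j = nat \<lfloor>R j * real (Suc m)\<rfloor>" for m j
    define Q where "Q m = (\<lambda>j\<in>{1..n}. real (t m j) / real (Suc m))" for m
    have Q: "Q m \<in> achievable_rates n A" for m
    proof -
      have "\<exists>\<phi> \<psi>. is_index_code n A (t m) (Suc m) \<phi> \<psi>"
      proof (rule codes)
        fix S assume S: "S \<subseteq> {1..n}" "acyclic (induced_subgraph (side_info_graph n A) S)"
        have "real (sum (t m) S) \<le> (\<Sum>j\<in>S. R j * real (Suc m))"
          unfolding of_nat_sum using Rpos S
          by (intro sum_mono) (auto simp: t_def simp del: of_nat_Suc)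
        also have "\<dots> = sum R S * real (Suc m)" by (simp add: sum_distrib_right)
        also have "\<dots> \<le> 1 * real (Suc m)"
          using R S by (intro mult_right_mono) (auto simp: MAIS_region_def)
        finally show "sum (t m) S \<le> Suc m" by (simp del: of_nat_Suc of_nat_sum)
      qed simp
      moreover have "Q m \<in> {1..n} \<rightarrow>\<^sub>E {0..}" by (auto simp: Q_def)
      moreover have "\<forall>j\<in>{1..n}. Q m j \<le> real (t m j) / real (Suc m)" by (simp add: Q_def)
      ultimately show ?thesis unfolding achievable_rates_def by blast
    qed
    have "limitin (powertop_real {1..n}) Q R sequentially"
      unfolding limitin_componentwise
    proof (intro conjI ballI Rext)
      show "\<forall>\<^sub>F m in sequentially. Q m \<in> topspace (powertop_real {1..n})"
        by (auto simp: Q_def)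
      fix j assume j: "j \<in> {1..n}"
      show "limitin euclideanreal (\<lambda>m. Q m j) (R j) sequentially"
        using floor_rate_tendsto[OF Rpos[OF j]] j by (simp add: Q_def t_def)
    qed
    moreover have "Q m \<in> capacity_region n A" for m
    proof -
      have "achievable_rates n A \<subseteq> topspace (powertop_real {1..n})"
        by (auto simp: achievable_rates_def PiE_def)
      then show ?thesis
        using Q closure_of_subset unfolding capacity_region_def by blast
    qed
    ultimately show "R \<in> capacity_region n A"
      by (intro limitin_closedin[of "powertop_real {1..n}" Q R sequentially])
        (auto simp: capacity_region_def)
  qed
qed

section \<open>Constructing codes\<close>

text \<open>The set \<open>E\<close> indexes the bits of the codeword, bit \<open>e\<close> being \<open>F x e\<close>.\<close>
lemma index_code_exists:
  fixes F :: "(nat \<Rightarrow> bool list) \<Rightarrow> 'e \<Rightarrow> bool"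
  assumes fin: "finite E" and card: "card E \<le> r" and r: "r > 0"
    and dec: "\<And>x y j. x \<in> messages {1..n} t \<Longrightarrow> y \<in> messages {1..n} t \<Longrightarrow> j \<in> {1..n} \<Longrightarrow>
      (\<And>e. e \<in> E \<Longrightarrow> F x e = F y e) \<Longrightarrow> (\<And>k. k \<in> A j \<Longrightarrow> x k = y k) \<Longrightarrow> x j = y j"
  shows "\<exists>\<phi> \<psi>. is_index_code n A t r \<phi> \<psi>"
proof -
  obtain es where es: "set es = E" "distinct es" using fin finite_distinct_list by blast
  have len: "length es \<le> r" using card es distinct_card by metis
  define \<phi> where "\<phi> x = map (F x) es @ replicate (r - length es) False" for x
  \<comment> \<open>The decoder picks any message tuple consistent with its input;
    \<open>dec\<close> makes component \<open>j\<close> unambiguous. The zero word only keeps the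
    length right on inputs that no message tuple produces.\<close>
  define P where "P j w z x \<longleftrightarrow> x \<in> messages {1..n} t \<and> \<phi> x = w \<and> restrict x (A j) = z" for j w z x
  define \<psi> where "\<psi> j = (\<lambda>(w, z). if \<exists>x. P j w z x then (SOME x. P j w z x) j
    else replicate (t j) False)" for j
  have "is_index_code n A t r \<phi> \<psi>"
    unfolding is_index_code_def
  proof (intro conjI r ballI)
    show "\<phi> \<in> messages {1..n} t \<rightarrow> bits r" using len by (auto simp: \<phi>_def bits_def)
  next
    fix j assume j: "j \<in> {1..n}"
    have "\<psi> j (w, z) \<in> bits (t j)" for w z
    proof (cases "\<exists>x. P j w z x")
      case True
      then have "P j w z (SOME x. P j w z x)" by (rule someI_ex)
      then have "length ((SOME x. P j w z x) j) = t j"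
        using j length_message unfolding P_def by blast
      then show ?thesis using True by (simp add: \<psi>_def bits_def)
    next
      case False
      then show ?thesis by (auto simp: \<psi>_def bits_def)
    qed
    then show "\<psi> j \<in> bits r \<times> messages (A j) t \<rightarrow> bits (t j)" by auto
  next
    fix j x assume j: "j \<in> {1..n}" and x: "x \<in> messages {1..n} t"
    let ?P = "P j (\<phi> x) (restrict x (A j))"
    define y where "y = (SOME y. ?P y)"
    have ex: "\<exists>y. ?P y" using x by (auto simp: P_def)
    then have "?P y" unfolding y_def by (rule someI_ex)
    then have y: "y \<in> messages {1..n} t" and \<phi>: "\<phi> y = \<phi> x"
      and rst: "restrict y (A j) = restrict x (A j)" by (auto simp: P_def)
    have "y j = x j"
    proof (rule dec[OF y x j])
      show "F y e = F x e" if "e \<in> E" for e using \<phi> that es by (auto simp: \<phi>_def)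
      show "y k = x k" if "k \<in> A j" for k using rst that by (metis restrict_apply')
    qed
    then show "\<psi> j (\<phi> x, restrict x (A j)) = x j" using ex by (simp add: \<psi>_def y_def)
  qed
  then show ?thesis by blast
qed

lemma index_code_shared_shortest:
  assumes icp: "index_coding_problem n A" and r: "r > 0" and ne: "\<And>j. j \<in> {1..n} \<Longrightarrow> A j \<noteq> {}"
    and le: "\<And>j. j \<in> {1..n} \<Longrightarrow> sum t ({1..n} - {j}) \<le> r"
  shows "\<exists>\<phi> \<psi>. is_index_code n A t r \<phi> \<psi>"
proof -
  have sub: "A j \<subseteq> {1..n} - {j}" if "j \<in> {1..n}" for j
    using icp that by (auto simp: index_coding_problem_def)
  have "{1..n} \<noteq> {}" using icp by (auto simp: index_coding_problem_def)
  then obtain c where c: "c \<in> {1..n}" and min: "\<And>j. j \<in> {1..n} \<Longrightarrow> t c \<le> t j"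
    using ex_is_arg_min_if_finite[of "{1..n}" t] by (auto simp: is_arg_min_linorder)
  let ?E = "Sigma ({1..n} - {c}) (\<lambda>j. {..<t j})"
  \<comment> \<open>On booleans \<open>\<noteq>\<close> is exclusive or; the shortest message
    \<open>c\<close> is padded with zeros.\<close>
  let ?F = "\<lambda>x (j, k). x j ! k \<noteq> (k < t c \<and> x c ! k)"
  show ?thesis
  proof (rule index_code_exists[OF _ _ r, where E = ?E and F = ?F])
    show "finite ?E" by auto
    show "card ?E \<le> r" using le[OF c] by (simp add: card_SigmaI)
  next
    fix x y j
    assume x: "x \<in> messages {1..n} t" and y: "y \<in> messages {1..n} t" and j: "j \<in> {1..n}"
      and F: "\<And>e. e \<in> ?E \<Longrightarrow> ?F x e = ?F y e" and side: "\<And>k. k \<in> A j \<Longrightarrow> x k = y k"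
    have tail: "x i ! k = y i ! k" if "i \<in> {1..n}" "t c \<le> k" "k < t i" for i k
      using F[of "(i, k)"] that by (cases "i = c") auto
    \<comment> \<open>Two inputs with the same codeword differ at bit \<open>k < t c\<close> either
      in all messages or in none.\<close>
    have head: "(x i ! k = y i ! k) = (x c ! k = y c ! k)" if "i \<in> {1..n}" "k < t c" for i k
      using F[of "(i, k)"] that min[of i] by (cases "i = c") auto
    obtain i where i: "i \<in> A j" using ne[OF j] by blast
    then have "i \<in> {1..n}" using sub[OF j] by blast
    then have "x j ! k = y j ! k" if "k < t j" for k
      using head[of i k] head[of j k] tail[of j k] side[OF i] that j by fastforce
    then show "x j = y j"
      using x y j by (intro nth_equalityI) (auto simp: length_message)
  qed
qed

text \<open>The number of bits of the message at position \<open>i\<close> of a path that the greedy code has not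
  transmitted together with bits of position \<open>i - 1\<close>; here \<open>b i\<close> says that positions \<open>i\<close> and
  \<open>Suc i\<close> know each other.\<close>
primrec residual :: "(nat \<Rightarrow> nat) \<Rightarrow> (nat \<Rightarrow> bool) \<Rightarrow> nat \<Rightarrow> nat" where
  "residual w b 0 = w 0"
| "residual w b (Suc i) = (if b i then w (Suc i) - residual w b i else w (Suc i))"

lemma residual_le: "residual w b i \<le> w i"
  by (cases i) auto

text \<open>Induction in steps of two: if \<open>b m\<close> holds and the last residual is
  positive, it adds up with the one before to \<open>w (Suc m)\<close>, so \<open>Suc m\<close>
  joins the set for the prefix without \<open>m\<close>. If it is zero, the previous set still
  serves.\<close>

lemma residual_independent_weight:
  "\<exists>S\<subseteq>{..<m}. (\<forall>i. b i \<longrightarrow> \<not> (i \<in> S \<and> Suc i \<in> S)) \<and> sum w S = sum (residual w b) {..<m}"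
proof (induction m rule: induct_nat_012)
  case 0
  show ?case by auto
next
  case 1
  show ?case by (intro exI[of _ "{0}"]) auto
next
  case (ge2 m)
  obtain S where S: "S \<subseteq> {..<m}" "\<forall>i. b i \<longrightarrow> \<not> (i \<in> S \<and> Suc i \<in> S)"
    "sum w S = sum (residual w b) {..<m}" using ge2(1) by blast
  obtain T where T: "T \<subseteq> {..<Suc m}" "\<forall>i. b i \<longrightarrow> \<not> (i \<in> T \<and> Suc i \<in> T)"
    "sum w T = sum (residual w b) {..<Suc m}" using ge2(2) by blast
  have fin: "finite S" "finite T" using S(1) T(1) finite_subset by blast+
  have nin: "Suc m \<notin> S" "Suc m \<notin> T" "Suc (Suc m) \<notin> S" "Suc (Suc m) \<notin> T" "m \<notin> S"
    using S(1) T(1) by auto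
  consider "\<not> b m" | "b m" "w (Suc m) \<le> residual w b m" | "b m" "residual w b m < w (Suc m)"
    by linarith
  then show ?case
  proof cases
    case 1
    then show ?thesis
      using T fin nin by (intro exI[of _ "insert (Suc m) T"]) auto
  next
    case 2
    then show ?thesis using T by (intro exI[of _ T]) auto
  next
    case 3
    then show ?thesis
      using S fin nin by (intro exI[of _ "insert (Suc m) S"]) auto
  qed
qed

text \<open>Position \<open>i\<close> sends its last \<open>d i\<close> bits, superposed with the
  first bits of position \<open>Suc i\<close> if \<open>b i\<close> holds. Its own block yields
  these bits, the block of the preceding position the earlier ones; in both cases the other summand
  is side information.\<close>

lemma index_code_greedy_path:
  assumes r: "r > 0" and v: "bij_betw v {..<n} {1..n}"
    and b: "\<And>i. b i \<Longrightarrow> Suc i < n \<and> v i \<in> A (v (Suc i)) \<and> v (Suc i) \<in> A (v i)"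
    and le: "sum (residual (t \<circ> v) b) {..<n} \<le> r"
  shows "\<exists>\<phi> \<psi>. is_index_code n A t r \<phi> \<psi>"
proof -
  define d where "d = residual (t \<circ> v) b"
  let ?E = "Sigma {..<n} (\<lambda>i. {..<d i})"
  let ?F = "\<lambda>x (i, k). x (v i) ! (t (v i) - d i + k) \<noteq>
    (b i \<and> k < t (v (Suc i)) \<and> x (v (Suc i)) ! k)"
  show ?thesis
  proof (rule index_code_exists[OF _ _ r, where E = ?E and F = ?F])
    show "finite ?E" by auto
    show "card ?E \<le> r" using le by (simp add: card_SigmaI d_def)
  next
    fix x y j
    assume x: "x \<in> messages {1..n} t" and y: "y \<in> messages {1..n} t" and j: "j \<in> {1..n}"
      and F: "\<And>e. e \<in> ?E \<Longrightarrow> ?F x e = ?F y e" and side: "\<And>k. k \<in> A j \<Longrightarrow> x k = y k"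
    obtain i where i: "i < n" "j = v i" using j v by (metis bij_betw_iff_bijections lessThan_iff)
    have "x j ! k = y j ! k" if k: "k < t j" for k
    proof (cases "t j - d i \<le> k")
      case True
      define l where "l = k - (t j - d i)"
      have "d i \<le> t j" using residual_le[of "t \<circ> v" b i] i by (simp add: d_def)
      then have l: "l < d i" "k = t (v i) - d i + l" using True k i by (auto simp: l_def)
      then have "?F x (i, l) = ?F y (i, l)" using i by (intro F) auto
      moreover have "x (v (Suc i)) = y (v (Suc i))" if "b i" using side b[OF that] i by auto
      ultimately show ?thesis using l i by auto
    next
      case False
      \<comment> \<open>Such a bit exists only if \<open>i\<close> has a predecessor
        \<open>i'\<close> with \<open>b i'\<close>; then \<open>t j - d i \<le> d i'\<close>, so the
        block of \<open>i'\<close> contains it.\<close>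
      then obtain i' where i': "i = Suc i'" "b i'" "k < d i'"
        using i k by (cases i) (auto simp: d_def split: if_splits)
      then have "?F x (i', k) = ?F y (i', k)" using i by (intro F) auto
      moreover have "x (v i') = y (v i')" using side b[OF i'(2)] i i' by auto
      ultimately show ?thesis using i i' k by auto
    qed
    then show "x j = y j"
      using x y j by (intro nth_equalityI) (auto simp: length_message)
  qed
qed

section \<open>Subgraphs of a cycle\<close>

text \<open>The path obtained by cutting the cycle after \<open>c\<close>: for \<open>c\<close> in
  \<open>{1..n}\<close>, position \<open>0\<close> is the successor of \<open>c\<close> and position
  \<open>n - 1\<close> is \<open>c\<close>.\<close>

definition cyc_shift :: "nat \<Rightarrow> nat \<Rightarrow> nat \<Rightarrow> nat" where
  "cyc_shift n c i = (c + i) mod n + 1"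

lemma bij_betw_cyc_shift:
  assumes "n \<ge> 1"
  shows "bij_betw (cyc_shift n c) {..<n} {1..n}"
proof -
  have "inj_on (cyc_shift n c) {..<n}"
  proof (rule linorder_inj_onI)
    fix i j assume ij: "i < j" "i \<in> {..<n}" "j \<in> {..<n}"
    show "cyc_shift n c i \<noteq> cyc_shift n c j"
    proof
      assume "cyc_shift n c i = cyc_shift n c j"
      then have "(c + j) mod n = (c + i) mod n" by (simp add: cyc_shift_def)
      then have "n dvd (c + j) - (c + i)" using ij by (subst (asm) mod_eq_dvd_iff_nat) auto
      then show False using ij by (auto dest: dvd_imp_le)
    qed
  qed auto
  moreover have "cyc_shift n c ` {..<n} \<subseteq> {1..n}"
    using assms by (auto simp: cyc_shift_def Suc_le_eq)
  ultimately show ?thesis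
    by (simp add: bij_betw_def card_subset_eq card_image)
qed

lemma cyc_succ_shift: "n \<ge> 1 \<Longrightarrow> cyc_succ n (cyc_shift n c i) = cyc_shift n c (Suc i)"
  by (auto simp: cyc_succ_def cyc_shift_def mod_Suc)

lemma cyc_shift_eq_succ:
  assumes n: "n \<ge> 1" and ij: "i < n" "j < n" and eq: "cyc_shift n c j = cyc_succ n (cyc_shift n c i)"
  shows "j = Suc i \<or> (j = 0 \<and> Suc i = n)"
proof -
  have inj: "inj_on (cyc_shift n c) {..<n}" using bij_betw_cyc_shift[OF n] by (simp add: bij_betw_def)
  have eq': "cyc_shift n c j = cyc_shift n c (Suc i)" using eq cyc_succ_shift[OF n] by simp
  show ?thesis
  proof (cases "Suc i = n")
    case True
    then have eq0: "cyc_shift n c j = cyc_shift n c 0" using eq' by (simp add: cyc_shift_def)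
    have "j = 0" using inj_onD[OF inj eq0] ij by simp
    then show ?thesis using True by simp
  next
    case False
    then have "j = Suc i" using inj_onD[OF inj eq'] ij by simp
    then show ?thesis ..
  qed
qed

locale cyclic_side_info =
  fixes n :: nat and A :: "nat \<Rightarrow> nat set"
  assumes icp: "index_coding_problem n A"
    and nbr: "\<And>j. j \<in> {1..n} \<Longrightarrow> A j \<subseteq> {cyc_pred n j, cyc_succ n j}"
begin

lemma n_pos: "n \<ge> 1"
  using icp by (simp add: index_coding_problem_def)

lemma side_info_position:
  assumes ij: "i < n" "j < n" and mem: "cyc_shift n c i \<in> A (cyc_shift n c j)"
  shows "j = Suc i \<or> i = Suc j \<or> (j = 0 \<and> Suc i = n) \<or> (i = 0 \<and> Suc j = n)"
proof -
  have rng: "cyc_shift n c k \<in> {1..n}" if "k < n" for k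
    using bij_betw_apply[OF bij_betw_cyc_shift[OF n_pos]] that by blast
  from nbr[OF rng[OF ij(2)]] mem
  have "cyc_shift n c i = cyc_pred n (cyc_shift n c j) \<or>
      cyc_shift n c i = cyc_succ n (cyc_shift n c j)" by auto
  then have "cyc_shift n c j = cyc_succ n (cyc_shift n c i) \<or>
      cyc_shift n c i = cyc_succ n (cyc_shift n c j)"
    using rng[OF ij(1)] rng[OF ij(2)] by (auto simp: cyc_pred_def cyc_succ_def split: if_splits)
  then show ?thesis using cyc_shift_eq_succ[OF n_pos] ij by blast
qed

definition independent :: "nat set \<Rightarrow> bool" where
  "independent S \<longleftrightarrow> (\<forall>i\<in>S. \<forall>j\<in>S. \<not> (i \<in> A j \<and> j \<in> A i))"

text \<open>Deleting \<open>c\<close> turns the cycle into a path, and a path without opposite edges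
  contains no directed cycle.\<close>

lemma acyclic_independent_proper:
  assumes S: "S \<subseteq> {1..n} - {c}" "c \<in> {1..n}" and ind: "independent S"
  shows "acyclic (induced_subgraph (side_info_graph n A) S)"
proof -
  let ?v = "cyc_shift n (c - 1)"
  let ?p = "inv_into {..<n} ?v"
  have bij: "bij_betw ?v {..<n} {1..n}" using bij_betw_cyc_shift[OF n_pos] .
  have pos: "?p u < n" "?v (?p u) = u" "?p u \<noteq> 0" if "u \<in> S" for u
  proof -
    have u: "u \<in> {1..n}" "u \<noteq> c" using S that by auto
    show "?p u < n" "?v (?p u) = u"
      using bij_betw_apply[OF bij_betw_inv_into[OF bij] u(1)] bij_betw_inv_into_right[OF bij u(1)]
      by auto
    moreover have "?v 0 = c" using S by (auto simp: cyc_shift_def)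
    ultimately show "?p u \<noteq> 0" using u by metis
  qed
  text \<open>A potential on positions that increases along each edge: it goes up from \<open>i\<close> to \<open>Suc i\<close> if
    the edge points that way and down otherwise.\<close>
  define h :: "nat \<Rightarrow> int" where "h m = (\<Sum>i<m. if ?v i \<in> A (?v (Suc i)) then 1 else - 1)" for m
  have "h (?p u) < h (?p w)" if "(u, w) \<in> induced_subgraph (side_info_graph n A) S" for u w
  proof -
    have uw: "u \<in> S" "w \<in> S" "u \<in> A w"
      using that by (auto simp: induced_subgraph_def side_info_graph_def)
    \<comment> \<open>Position \<open>0\<close> is the deleted vertex \<open>c\<close>, which rules
      out edges between the two ends of the path.\<close>
    have "?p w = Suc (?p u) \<or> ?p u = Suc (?p w)"
      using side_info_position[of "?p u" "?p w" "c - 1"] pos[OF uw(1)] pos[OF uw(2)] uw(3) by auto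
    then show ?thesis
    proof
      assume eq: "?p w = Suc (?p u)"
      then have "?v (?p u) \<in> A (?v (Suc (?p u)))" using pos uw by metis
      then show ?thesis unfolding eq by (simp add: h_def)
    next
      assume eq: "?p u = Suc (?p w)"
      have "w \<notin> A u" using ind uw by (auto simp: independent_def)
      then have "?v (?p w) \<notin> A (?v (Suc (?p w)))" using pos uw eq by metis
      then show ?thesis unfolding eq by (simp add: h_def)
    qed
  qed
  \<comment> \<open>The sign is flipped because \<open>acyclicI_order\<close> wants a function that
    decreases along edges.\<close>
  then show ?thesis by (intro acyclicI_order[where f = "\<lambda>u. - h (?p u)"]) auto
qed

text \<open>A vertex without incoming edges lies on no directed cycle, so deleting it would leave a
  cycle in a proper independent set.\<close>

lemma side_info_nonempty_if_cyclic:
  assumes S: "S \<subseteq> {1..n}" "independent S" "\<not> acyclic (induced_subgraph (side_info_graph n A) S)"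
  shows "S = {1..n}" and "j \<in> {1..n} \<Longrightarrow> A j \<noteq> {}"
proof -
  show eq: "S = {1..n}"
    using acyclic_independent_proper S by blast
  show "A j \<noteq> {}" if j: "j \<in> {1..n}"
  proof
    assume empty: "A j = {}"
    let ?G = "\<lambda>S. induced_subgraph (side_info_graph n A) S"
    have no_in: "(u, j) \<notin> ?G S" for u
      using empty by (auto simp: induced_subgraph_def side_info_graph_def)
    \<comment> \<open>A walk that starts elsewhere can never enter \<open>j\<close>.\<close>
    have "(u, w) \<in> (?G ({1..n} - {j}))\<^sup>+" if "(u, w) \<in> (?G S)\<^sup>+" "u \<noteq> j" for u w
      using that
    proof (induction rule: trancl_induct)
      case (base w)
      then have "(u, w) \<in> ?G ({1..n} - {j})"
        using no_in by (auto simp: induced_subgraph_def eq)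
      then show ?case by blast
    next
      case (step w z)
      have "w \<noteq> j" using step(1) no_in by (metis tranclE)
      then have "(w, z) \<in> ?G ({1..n} - {j})"
        using no_in step(2) by (auto simp: induced_subgraph_def eq)
      then show ?case using step by (meson trancl_into_trancl)
    qed
    moreover have "(j, j) \<notin> (?G S)\<^sup>+" using no_in by (metis tranclE)
    moreover have "acyclic (?G ({1..n} - {j}))"
    proof (rule acyclic_independent_proper[OF subset_refl j])
      show "independent ({1..n} - {j})" using S(2) by (simp add: independent_def eq)
    qed
    ultimately show False using S(3) unfolding acyclic_def by metis
  qed
qed

text \<open>Besides consecutive positions only the two ends of the path are neighbours; these are
  \<open>c\<close> and its successor, where the cycle was cut.\<close>

lemma independent_path_set:
  assumes c: "c \<in> {1..n}" "\<not> (c \<in> A (cyc_succ n c) \<and> cyc_succ n c \<in> A c)"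
    and S: "S \<subseteq> {..<n}"
    and ind: "\<And>i. Suc i < n \<Longrightarrow> i \<in> S \<Longrightarrow> Suc i \<in> S \<Longrightarrow>
      \<not> (cyc_shift n c i \<in> A (cyc_shift n c (Suc i)) \<and> cyc_shift n c (Suc i) \<in> A (cyc_shift n c i))"
  shows "independent (cyc_shift n c ` S)"
  unfolding independent_def
proof (intro ballI, elim imageE, hypsubst, rule notI)
  fix i j assume ij: "i \<in> S" "j \<in> S"
    and bi: "cyc_shift n c i \<in> A (cyc_shift n c j) \<and> cyc_shift n c j \<in> A (cyc_shift n c i)"
  have lt: "i < n" "j < n" using ij S by auto
  have first: "cyc_shift n c 0 = cyc_succ n c"
    using c(1) by (auto simp: cyc_shift_def cyc_succ_def)
  have last: "cyc_shift n c k = c" if "Suc k = n" for k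
  proof -
    have "c + k = (c - 1) + n" using that c(1) by auto
    then have "(c + k) mod n = (c - 1) mod n" by simp
    also have "\<dots> = c - 1" using c(1) by (intro mod_less) auto
    finally show ?thesis using c(1) by (simp add: cyc_shift_def)
  qed
  from side_info_position[OF lt conjunct1[OF bi]] show False
    using ind ij lt bi first last c(2) by metis
qed

end

theorem proposition7:
  fixes n :: nat and A :: "nat \<Rightarrow> nat set"
  assumes "index_coding_problem n A"
    and "\<forall>j\<in>{1..n}. A j \<subseteq> {cyc_pred n j, cyc_succ n j}"
    and "\<exists>j\<in>{1..n}. A j \<subset> {cyc_pred n j, cyc_succ n j}"
  shows "capacity_region n A = MAIS_region n A"
proof (rule MAIS_tightI[OF assms(1)])
  interpret cyclic_side_info n A using assms by unfold_locales auto
  fix t :: "nat \<Rightarrow> nat" and r :: nat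
  assume r: "r > 0"
    and le: "\<And>S. S \<subseteq> {1..n} \<Longrightarrow> acyclic (induced_subgraph (side_info_graph n A) S) \<Longrightarrow> sum t S \<le> r"
  show "\<exists>\<phi> \<psi>. is_index_code n A t r \<phi> \<psi>"
  proof (cases "\<forall>S\<subseteq>{1..n}. independent S \<longrightarrow> acyclic (induced_subgraph (side_info_graph n A) S)")
    case True
    obtain j where j: "j \<in> {1..n}" "\<not> (cyc_pred n j \<in> A j \<and> cyc_succ n j \<in> A j)"
      using assms(3) by blast
    have "cyc_pred n j \<in> {1..n}" "cyc_succ n (cyc_pred n j) = j"
      using j(1) by (auto simp: cyc_pred_def cyc_succ_def)
    \<comment> \<open>If \<open>A j\<close> lacks the predecessor of \<open>j\<close>, that
      predecessor serves as \<open>c\<close>; otherwise it lacks the successor and \<open>j\<close>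
      itself serves.\<close>
    then obtain c where c: "c \<in> {1..n}" "\<not> (c \<in> A (cyc_succ n c) \<and> cyc_succ n c \<in> A c)"
      using j by metis
    let ?v = "cyc_shift n c"
    define b where "b i \<longleftrightarrow> Suc i < n \<and> ?v i \<in> A (?v (Suc i)) \<and> ?v (Suc i) \<in> A (?v i)" for i
    have bij: "bij_betw ?v {..<n} {1..n}" using bij_betw_cyc_shift[OF n_pos] .
    obtain S where S: "S \<subseteq> {..<n}" "\<forall>i. b i \<longrightarrow> \<not> (i \<in> S \<and> Suc i \<in> S)"
      "sum (t \<circ> ?v) S = sum (residual (t \<circ> ?v) b) {..<n}"
      using residual_independent_weight[of n b "t \<circ> ?v"] by auto
    have "independent (?v ` S)"
      using S(2) by (intro independent_path_set[OF c S(1)]) (auto simp: b_def)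
    moreover have sub: "?v ` S \<subseteq> {1..n}" using S(1) bij by (auto simp: bij_betw_def)
    ultimately have "sum t (?v ` S) \<le> r" using True le by blast
    moreover have "sum t (?v ` S) = sum (t \<circ> ?v) S"
      using bij S(1) by (intro sum.reindex) (auto simp: bij_betw_def intro: inj_on_subset)
    ultimately show ?thesis
      using S(3) by (intro index_code_greedy_path[OF r bij, of b]) (auto simp: b_def)
  next
    case False
    then obtain S where S: "S \<subseteq> {1..n}" "independent S"
      "\<not> acyclic (induced_subgraph (side_info_graph n A) S)" by blast
    note cyclic = side_info_nonempty_if_cyclic[OF S]
    show ?thesis
    proof (rule index_code_shared_shortest[OF icp r cyclic(2)])
      fix j assume j: "j \<in> {1..n}"
      have "independent ({1..n} - {j})" using S(2) cyclic(1) by (auto simp: independent_def)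
      then show "sum t ({1..n} - {j}) \<le> r"
        using j by (intro le acyclic_independent_proper) auto
    qed
  qed
qed

end
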